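(* Let $p$ be a prime, let $d$ be an even positive integer properly dividing $p-1$ (that is, $d \mid p-1$ and $d\neq p-1$), and suppose $A \subseteq \mathbb{F}_p$ is such that \[ \{a-a' : a,a'\in A,\ a\neq a'\} = Z_d, \] where $Z_d = \{z \in \mathbb{F}_p : z^d = 1\}$. Then each difference $a-a'$ with $a, a' \in A$, $a\neq a'$, is unique, i.e. if $a_1-a_1' = a_2-a_2'$ with $a_1\neq a_1'$, $a_2\neq a_2'$ all in $A$, then $(a_1,a_1')=(a_2,a_2')$. Consequently, when $d=\frac{p-1}{2}$, the prime $p$ is of the form $\frac{n^2+1}{2}$ for some odd integer $n$, and hence for almost every prime $p$ there is no such decomposition with $d=\frac{p-1}{2}$: as $x\to\infty$, the number of odd primes $p\leq x$ for which there exists $A\subseteq \mathbb{F}_p$ with $\{a-a' : a,a'\in A,\ a\neq a'\} = Z_{\frac{p-1}{2}}$ is $o(\pi(x))$.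
   Context: $\mathbb{F}_p$ is the field with $p$ elements. $\pi(x)$ denotes the number of primes $p\leq x$. *)

theory Defs
  imports "HOL-Number_Theory.Residues" "HOL-Library.Landau_Symbols"
begin

text \<open>The field with \<open>p\<close> elements, with carrier \<open>{0..int p - 1}\<close>.\<close>

abbreviation prime_field :: "nat \<Rightarrow> int ring" where
  "prime_field p \<equiv> residue_ring (int p)"

definition distinct_differences :: "('a, 'b) ring_scheme \<Rightarrow> 'a set \<Rightarrow> 'a set" where
  "distinct_differences R A = {a \<ominus>\<^bsub>R\<^esub> a' | a a'. a \<in> A \<and> a' \<in> A \<and> a \<noteq> a'}"

definition unity_roots :: "('a, 'b) ring_scheme \<Rightarrow> nat \<Rightarrow> 'a set" where
  "unity_roots R d = {z \<in> carrier R. z [^]\<^bsub>R\<^esub> d = \<one>\<^bsub>R\<^esub>}"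

definition prime_pi :: "real \<Rightarrow> nat" where
  "prime_pi x = card {p :: nat. prime p \<and> real p \<le> x}"

end

theory Submission
  imports Defs "HOL-Number_Theory.Residue_Primitive_Roots" "HOL-Real_Asymp.Real_Asymp"
    "HOL-Computational_Algebra.Polynomial"
begin

text \<open>
  Stepanov's method bounds \<open>m = card A\<close> by \<open>m * (m - 1) \<le> d\<close>: with weights \<open>w a\<close> that annihilate the
  power sums of \<open>A\<close> of exponent below \<open>m - 1\<close>, the polynomial \<open>\<Sum>a\<in>A. w a * (a - X) ^ (d + m - 1)\<close>
  has degree \<open>d\<close>. Since \<open>(a - b) ^ d = 1\<close> for distinct \<open>a, b \<in> A\<close>, after subtraction of a constant it
  vanishes to order \<open>m - 1\<close> at every \<open>b \<in> A\<close>, so \<open>m * (m - 1) \<le> d\<close>. The \<open>m * (m - 1)\<close> pairs of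
  distinct elements of \<open>A\<close> map onto the \<open>d\<close> elements of \<open>Z_d\<close>, hence bijectively, and \<open>d = m * (m - 1)\<close>.
  For \<open>d = (p - 1) / 2\<close> this leaves only \<open>O(sqrt x)\<close> primes, which is negligible by Chebyshev's lower
  bound on the number of primes. That bound follows from \<open>2 ^ (N - 1) \<le> Lcm {1..N} \<le> N ^ prime_pi N\<close>.

  As the prime varies and types cannot depend on it, polynomials over the field with \<open>p\<close> elements are
  replaced by integer polynomials modulo the constant polynomial \<open>[:p:]\<close>.
\<close>

section \<open>Lagrange weights and the Stepanov polynomial\<close>

lemma smult_sum_poly_right: "smult c (\<Sum>i\<in>I. f i) = (\<Sum>i\<in>I. smult c (f i))"
  by (induction I rule: infinite_finite_induct) (auto simp: smult_add_right)

text \<open>Up to sign the discriminant of the monic polynomial with simple roots exactly at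
  \<open>A\<close>.\<close>

definition node_product :: "'a::idom set \<Rightarrow> 'a" where
  "node_product A = (\<Prod>x\<in>A. \<Prod>y\<in>A - {x}. x - y)"

text \<open>For \<open>a \<in> A\<close>, this is the barycentric weight
  \<open>1 / (\<Prod>y\<in>A - {a}. a - y)\<close> multiplied by
  \<open>node_product A\<close>.\<close>

definition lagrange_weight :: "'a::idom set \<Rightarrow> 'a \<Rightarrow> 'a" where
  "lagrange_weight A a = (\<Prod>x\<in>A - {a}. \<Prod>y\<in>A - {x}. x - y)"

text \<open>
  Lagrange interpolation with denominators cleared by \<open>node_product A\<close>, so that it holds over the integers.
\<close>

lemma sum_lagrange_weight_poly:
  fixes A :: "'a::idom set" and q :: "'a poly"
  assumes "finite A" "degree q < card A"
  shows "(\<Sum>a\<in>A. lagrange_weight A a * poly q a) = node_product A * coeff q (card A - 1)"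
proof -
  define L where "L a = (\<Prod>y\<in>A - {a}. [:- y, 1:])" for a
  \<comment> \<open>\<open>F\<close> is the interpolation error times \<open>node_product A\<close>.
    It has \<open>card A\<close> roots but smaller degree, hence is 0; its coefficient of degree
    \<open>card A - 1\<close> is the claim.\<close>
  define F where "F = smult (node_product A) q
    - (\<Sum>a\<in>A. smult (lagrange_weight A a * poly q a) (L a))"
  have degL: "degree (L a) = card A - 1" if "a \<in> A" for a
    using that assms(1) by (simp add: L_def degree_prod_eq_sum_degree)
  have lcL: "coeff (L a) (card A - 1) = 1" if "a \<in> A" for a
    using lead_coeff_prod[of "\<lambda>y. [:- y, 1:]" "A - {a}"] degL[OF that] by (simp add: L_def)
  have polyL: "poly (L a) x = (if x = a then \<Prod>y\<in>A - {a}. a - y else 0)"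
    if "a \<in> A" "x \<in> A" for a x
    using that assms(1) by (auto simp: L_def poly_prod intro!: prod_zero)
  have "poly F x = 0" if x: "x \<in> A" for x
  proof -
    have "(\<Sum>a\<in>A. lagrange_weight A a * poly q a * poly (L a) x)
        = (\<Sum>a\<in>A. if a = x then lagrange_weight A a * poly q a * (\<Prod>y\<in>A - {a}. a - y) else 0)"
      by (rule sum.cong) (use x polyL in auto)
    also have "\<dots> = lagrange_weight A x * poly q x * (\<Prod>y\<in>A - {x}. x - y)"
      using assms(1) x by simp
    also have "\<dots> = node_product A * poly q x"
      using prod.remove[OF assms(1) x, of "\<lambda>x. \<Prod>y\<in>A - {x}. x - y"]
      by (simp add: lagrange_weight_def node_product_def)
    finally show ?thesis by (simp add: F_def poly_sum)
  qed
  then have sub: "A \<subseteq> {x. poly F x = 0}" by auto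
  have "degree F \<le> card A - 1"
    unfolding F_def using assms degL
    by (intro degree_diff_le degree_sum_le) (auto intro: order.trans[OF degree_smult_le])
  have "F = 0"
  proof (rule ccontr)
    assume F: "F \<noteq> 0"
    then have "card A \<le> degree F"
      using card_poly_roots_bound[OF F] card_mono[OF poly_roots_finite[OF F] sub] by simp
    then show False using \<open>degree F \<le> _\<close> assms(2) by linarith
  qed
  then have "coeff F (card A - 1) = 0" by simp
  then show ?thesis
    using lcL by (simp add: F_def coeff_sum)
qed

text \<open>The shift is free because \<open>(X - t) ^ k\<close> is monic of degree \<open>k\<close>
  for every \<open>t\<close>; later \<open>t\<close> is 0 or a point of \<open>A\<close>.\<close>

lemma sum_lagrange_weight_power:
  fixes A :: "'a::idom set"
  assumes "finite A" "k < card A"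
  shows "(\<Sum>a\<in>A. lagrange_weight A a * (a - t) ^ k)
    = (if k = card A - 1 then node_product A else 0)"
proof -
  have deg: "degree ([:- t, 1:] ^ k) = k"
    by (simp add: degree_power_eq)
  have "coeff ([:- t, 1:] ^ k) k = 1"
    using lead_coeff_power[of "[:- t, 1:]" k] deg by simp
  then show ?thesis
    using sum_lagrange_weight_poly[OF assms(1), of "[:- t, 1:] ^ k"] assms(2) deg
    by (auto simp: coeff_eq_0 algebra_simps)
qed

text \<open>Used with \<open>N = d + card A - 1\<close>. If distinct elements of \<open>A\<close>
  differ by \<open>d\<close>-th roots of unity modulo \<open>p\<close> and
  \<open>card A > 1\<close>, the subtracted constant is the value of the sum, modulo
  \<open>p\<close>, at every point of \<open>A\<close>.\<close>

definition stepanov_poly :: "'a::idom set \<Rightarrow> nat \<Rightarrow> 'a poly" where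
  "stepanov_poly A N = (\<Sum>a\<in>A. smult (lagrange_weight A a) ([:a, -1:] ^ N)) - [:node_product A:]"

text \<open>Taylor expansion around \<open>b\<close>, from \<open>a - X = (b - X) + (a - b)\<close>.
  The centre 0 gives the coefficients, a centre in \<open>A\<close> the vanishing order.\<close>

lemma stepanov_poly_expand:
  "stepanov_poly A N =
    (\<Sum>i\<le>N. smult (of_nat (N choose i) * (\<Sum>a\<in>A. lagrange_weight A a * (a - b) ^ (N - i)))
      ([:b, -1:] ^ i)) - [:node_product A:]"
proof -
  have "[:a, -1:] ^ N =
    (\<Sum>i\<le>N. smult (of_nat (N choose i) * (a - b) ^ (N - i)) ([:b, -1:] ^ i))" for a
  proof -
    have "[:a, -1:] ^ N = ([:b, -1:] + [:a - b:]) ^ N" by simp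
    also have "\<dots> = (\<Sum>i\<le>N. of_nat (N choose i) * [:b, -1:] ^ i * [:a - b:] ^ (N - i))"
      by (rule binomial_ring)
    also have "\<dots> = (\<Sum>i\<le>N. smult (of_nat (N choose i) * (a - b) ^ (N - i)) ([:b, -1:] ^ i))"
      by (intro sum.cong refl)
        (simp add: poly_const_pow of_nat_poly mult.commute)
    finally show ?thesis .
  qed
  then show ?thesis
    unfolding stepanov_poly_def
    by (simp add: smult_sum_poly_right sum.swap[of _ _ A] smult_sum sum_distrib_left mult_ac)
qed

lemma coeff_minus_X_power:
  "coeff ([:0, -1:: 'a::comm_ring_1:] ^ i) k = (if k = i then (-1) ^ i else 0)"
proof -
  have "[:0, -1:: 'a:] = monom (-1) 1" by (simp add: monom_altdef)
  then show ?thesis by (simp add: monom_power)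
qed

text \<open>For \<open>d \<le> k \<le> d + card A - 1\<close> the coefficient contains the weighted
  power sum of exponent \<open>d + card A - 1 - k\<close>, at most \<open>card A - 1\<close>. The
  weights annihilate it unless \<open>k = d\<close>, so the degree is at most
  \<open>d\<close>.\<close>

lemma coeff_stepanov_poly:
  fixes A :: "'a::idom set"
  assumes "finite A" "A \<noteq> {}" "0 < d" "d \<le> k"
  shows "coeff (stepanov_poly A (d + card A - 1)) k =
    (if k = d then (-1) ^ d * of_nat ((d + card A - 1) choose d) * node_product A else 0)"
proof -
  let ?N = "d + card A - 1"
  have "0 < card A" using assms by (simp add: card_gt_0_iff)
  have "coeff (stepanov_poly A ?N) k = (if k \<le> ?N then of_nat (?N choose k) *
      (\<Sum>a\<in>A. lagrange_weight A a * a ^ (?N - k)) * (-1) ^ k else 0)"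
    using assms unfolding stepanov_poly_expand[of A ?N 0]
    by (simp add: coeff_sum coeff_minus_X_power if_distrib[of "(*) _"] coeff_pCons cong: if_cong split: nat.split)
  then show ?thesis
    using sum_lagrange_weight_power[OF assms(1), of "?N - k" 0] assms \<open>0 < card A\<close>
    by (auto simp: algebra_simps)
qed


section \<open>Vanishing orders of polynomials modulo a constant\<close>

text \<open>For integer polynomials and prime \<open>c\<close> this is coprimality of the reductions
  modulo \<open>c\<close>.\<close>

definition comaximal_mod :: "'a::comm_ring_1 \<Rightarrow> 'a poly \<Rightarrow> 'a poly \<Rightarrow> bool" where
  "comaximal_mod c f g \<longleftrightarrow> (\<exists>u v. [:c:] dvd f * u + g * v - 1)"

lemma comaximal_mod_commute: "comaximal_mod c f g \<Longrightarrow> comaximal_mod c g f"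
  unfolding comaximal_mod_def by (metis add.commute)

lemma comaximal_mod_1: "comaximal_mod c f 1"
  unfolding comaximal_mod_def by (rule exI[of _ 0], rule exI[of _ 1]) simp

text \<open>Multiply the two Bezout identities: every term except \<open>(g * h) * (v * v')\<close>
  contains \<open>f\<close>.\<close>

lemma comaximal_mod_mult:
  assumes "comaximal_mod c f g" "comaximal_mod c f h"
  shows "comaximal_mod c f (g * h)"
proof -
  obtain u v u' v' where uv: "[:c:] dvd f * u + g * v - 1" "[:c:] dvd f * u' + h * v' - 1"
    using assms unfolding comaximal_mod_def by blast
  have "f * (u * f * u' + u * h * v' + g * v * u') + (g * h) * (v * v') - 1
      = (f * u + g * v - 1) * (f * u' + h * v') + (f * u' + h * v' - 1)"
    by (simp add: algebra_simps)
  then show ?thesis using uv unfolding comaximal_mod_def by (metis dvd_add dvd_mult2)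
qed

lemma comaximal_mod_prod:
  "(\<And>i. i \<in> I \<Longrightarrow> comaximal_mod c f (g i)) \<Longrightarrow> comaximal_mod c f (\<Prod>i\<in>I. g i)"
  by (induction I rule: infinite_finite_induct) (auto simp: comaximal_mod_1 comaximal_mod_mult)

lemma comaximal_mod_power: "comaximal_mod c f g \<Longrightarrow> comaximal_mod c f (g ^ k)"
  by (induction k) (auto simp: comaximal_mod_1 comaximal_mod_mult)

text \<open>The two linear polynomials differ by the constant \<open>x - y\<close>, which is
  invertible modulo \<open>p\<close>.\<close>

lemma comaximal_mod_linear:
  fixes p x y :: int
  assumes "prime p" "\<not> p dvd x - y"
  shows "comaximal_mod p [:x, -1:] [:y, -1:]"
proof -
  have "coprime (x - y) p"
    using assms by (simp add: prime_imp_coprime coprime_commute)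
  then obtain t where "[(x - y) * t = 1] (mod p)"
    by (auto simp: coprime_iff_invertible_int)
  then have "[:p:] dvd [:x, -1:] * [:t:] + [:y, -1:] * [:- t:] - 1"
    by (simp add: cong_iff_dvd_diff algebra_simps one_pCons)
  then show ?thesis unfolding comaximal_mod_def by blast
qed

lemma dvd_mod_comaximal_prod:
  assumes "finite I"
    and "\<And>i j. i \<in> I \<Longrightarrow> j \<in> I \<Longrightarrow> i \<noteq> j \<Longrightarrow> comaximal_mod c (g i) (g j)"
    and "\<And>i. i \<in> I \<Longrightarrow> \<exists>q. [:c:] dvd f - g i * q"
  shows "\<exists>q. [:c:] dvd f - (\<Prod>i\<in>I. g i) * q"
  using assms
proof (induction I)
  case empty
  show ?case by (rule exI[of _ f]) simp
next
  case (insert b I)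
  let ?G = "\<Prod>i\<in>I. g i"
  obtain q s where qs: "[:c:] dvd f - ?G * q" "[:c:] dvd f - g b * s"
    using insert by (metis insert_iff)
  have "comaximal_mod c (g b) ?G"
    using insert by (intro comaximal_mod_prod) auto
  then obtain u v where uv: "[:c:] dvd g b * u + ?G * v - 1"
    unfolding comaximal_mod_def by blast
  \<comment> \<open>Modulo \<open>c\<close>, split \<open>f\<close> as
    \<open>f * (g b * u) + f * (?G * v)\<close> and replace \<open>f\<close> by
    \<open>?G * q\<close> in the first summand and by \<open>g b * s\<close> in the second.\<close>
  have "f - (g b * ?G) * (q * u + s * v)
      = (f - ?G * q) * (g b * u) + (f - g b * s) * (?G * v) - (g b * u + ?G * v - 1) * f"
    by (simp add: algebra_simps)
  then have "[:c:] dvd f - (g b * ?G) * (q * u + s * v)"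
    using qs uv by (metis dvd_add dvd_diff dvd_mult2)
  then show ?case using insert by auto
qed

lemma const_dvd_if_degree_less:
  fixes f G q :: "int poly"
  assumes p: "p > 0" and dvd: "[:p:] dvd f - G * q"
    and G: "is_unit (lead_coeff G)" and deg: "degree f < degree G"
  shows "[:p:] dvd f"
proof -
  \<comment> \<open>After reduction of the coefficients to \<open>{0..<p}\<close>, a nonzero leading
    coefficient of \<open>r\<close> is not divisible by \<open>p\<close>. Then the top coefficient
    of \<open>G * r\<close>, in a degree above that of \<open>f\<close>, could not vanish modulo
    \<open>p\<close>.\<close>
  define r where "r = map_poly (\<lambda>x. x mod p) q"
  have "[:p:] dvd q - r"
    by (simp add: const_poly_dvd_iff r_def coeff_map_poly)
  then have "[:p:] dvd (f - G * q) + G * (q - r)"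
    using dvd by (intro dvd_add dvd_mult)
  then have dvd_r: "[:p:] dvd f - G * r" by (simp add: algebra_simps)
  have "r = 0"
  proof (rule ccontr)
    assume "r \<noteq> 0"
    have "p dvd coeff (f - G * r) (degree G + degree r)"
      using dvd_r by (simp add: const_poly_dvd_iff)
    then have "p dvd lead_coeff G * lead_coeff r"
      using deg by (simp add: coeff_mult_degree_sum coeff_eq_0)
    then have "p dvd lead_coeff r"
      using G by (metis dvd_mult_unit_iff' is_unit_mult_iff)
    moreover have "0 \<le> lead_coeff r" "lead_coeff r < p"
      using p by (simp_all add: r_def coeff_map_poly)
    ultimately have "lead_coeff r = 0"
      using zdvd_imp_le by force
    then show False using \<open>r \<noteq> 0\<close> by simp
  qed
  then show ?thesis using dvd_r by simp
qed

section \<open>The bound on difference sets\<close>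

text \<open>In the expansion around \<open>b\<close>, a term of order \<open>i < card A - 1\<close>
  has the exponent \<open>d + (card A - 1 - i)\<close>. The factor \<open>(a - b) ^ d\<close> is 1
  modulo \<open>p\<close> for \<open>a \<noteq> b\<close>, which leaves a sum known from the
  weights: 0 for \<open>i > 0\<close>, and the subtracted constant for \<open>i = 0\<close>.\<close>

lemma stepanov_poly_vanishing:
  fixes A :: "int set" and p :: int
  assumes A: "finite A" and b: "b \<in> A" and d: "d > 0"
    and diff: "\<And>x y. x \<in> A \<Longrightarrow> y \<in> A \<Longrightarrow> x \<noteq> y \<Longrightarrow> [(x - y) ^ d = 1] (mod p)"
  shows "\<exists>q. [:p:] dvd stepanov_poly A (d + card A - 1) - [:b, -1:] ^ (card A - 1) * q"
proof (cases "card A = 1")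
  case True
  then show ?thesis by (intro exI[of _ "stepanov_poly A (d + card A - 1)"]) simp
next
  case False
  let ?m = "card A - 1" and ?L = "[:b, -1:]"
  let ?N = "d + card A - 1"
  have m: "?m > 0" using False A b by (metis One_nat_def card_0_eq empty_iff gr0I le_antisym diff_is_0_eq leI less_one)
  define e where "e i = of_nat (?N choose i) *
    (\<Sum>a\<in>A. lagrange_weight A a * (a - b) ^ (?N - i))" for i
  define e' where "e' i = e i - (if i = 0 then node_product A else 0)" for i
  have e': "p dvd e' i" if i: "i < ?m" for i
  proof -
    have "[(a - b) ^ (?N - i) = (a - b) ^ (?m - i)] (mod p)" if a: "a \<in> A" for a
    proof (cases "a = b")
      \<comment> \<open>On the diagonal \<open>(a - b) ^ d\<close> is 0, not 1, but both powers are
        0 since \<open>i < card A - 1\<close> keeps the exponents positive.\<close>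
      case True
      moreover have "?N - i > 0" "?m - i > 0" using i d by simp_all
      ultimately show ?thesis by (simp add: zero_power)
    next
      case False
      have "?N - i = d + (?m - i)" using i by simp
      then show ?thesis
        using cong_scalar_right[OF diff[OF a b False], of "(a - b) ^ (?m - i)"]
        by (simp add: power_add)
    qed
    then have "[(\<Sum>a\<in>A. lagrange_weight A a * (a - b) ^ (?N - i))
        = (\<Sum>a\<in>A. lagrange_weight A a * (a - b) ^ (?m - i))] (mod p)"
      by (intro cong_sum cong_scalar_left)
    also have "(\<Sum>a\<in>A. lagrange_weight A a * (a - b) ^ (?m - i))
        = (if i = 0 then node_product A else 0)"
      using sum_lagrange_weight_power[OF A, of "?m - i" b] m i by auto
    finally have "[e i = of_nat (?N choose i) * (if i = 0 then node_product A else 0)] (mod p)"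
      unfolding e_def by (rule cong_scalar_left)
    then show ?thesis by (auto simp: e'_def cong_iff_dvd_diff split: if_splits)
  qed
  define q where "q = (\<Sum>i\<in>{?m..?N}. smult (e i) (?L ^ (i - ?m)))"
  have "stepanov_poly A ?N = (\<Sum>i\<le>?N. smult (e i) (?L ^ i)) - [:node_product A:]"
    unfolding e_def by (rule stepanov_poly_expand)
  also have "{..?N} = {..<?m} \<union> {?m..?N}" by auto
  also have "(\<Sum>i\<in>{..<?m} \<union> {?m..?N}. smult (e i) (?L ^ i))
      = (\<Sum>i<?m. smult (e i) (?L ^ i)) + (\<Sum>i\<in>{?m..?N}. smult (e i) (?L ^ i))"
    by (rule sum.union_disjoint) auto
  also have "(\<Sum>i\<in>{?m..?N}. smult (e i) (?L ^ i)) = ?L ^ ?m * q"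
    unfolding q_def sum_distrib_left
    by (intro sum.cong refl) (simp add: power_add[symmetric])
  finally have "stepanov_poly A ?N - ?L ^ ?m * q
      = (\<Sum>i<?m. smult (e i) (?L ^ i)) - [:node_product A:]"
    by simp
  also have "[:node_product A:] = (\<Sum>i<?m. smult (if i = 0 then node_product A else 0) (?L ^ i))"
    using m by (simp add: if_distrib[of "\<lambda>c. smult c _"] sum.delta cong: if_cong)
  also have "(\<Sum>i<?m. smult (e i) (?L ^ i)) - \<dots> = (\<Sum>i<?m. smult (e' i) (?L ^ i))"
    by (simp add: e'_def smult_diff_left sum_subtractf)
  also have "[:p:] dvd \<dots>"
    using e' by (intro dvd_sum) (auto simp: const_poly_dvd_iff)
  finally show ?thesis by blast
qed

lemma not_dvd_node_product:
  fixes A :: "int set"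
  assumes "prime p" "finite A" "\<And>x y. x \<in> A \<Longrightarrow> y \<in> A \<Longrightarrow> x \<noteq> y \<Longrightarrow> \<not> p dvd x - y"
  shows "\<not> p dvd node_product A"
  using assms unfolding node_product_def by (auto simp: prime_dvd_prod_iff)

text \<open>If the bound fails, the vanishing orders exceed the degree and the Stepanov polynomial
  is 0 modulo \<open>p\<close>. Its coefficient of degree \<open>d\<close> contradicts this: as
  \<open>d + card A - 1 < p\<close>, the binomial coefficient divides a factorial prime to
  \<open>p\<close>.\<close>

lemma difference_set_bound_aux:
  fixes A :: "int set" and p d :: nat
  assumes p: "prime p" and A: "finite A" and d: "d > 0" and card: "d + card A \<le> p"
    and diff: "\<And>x y. x \<in> A \<Longrightarrow> y \<in> A \<Longrightarrow> x \<noteq> y \<Longrightarrow> [(x - y) ^ d = 1] (mod int p)"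
  shows "card A * (card A - 1) \<le> d"
proof (rule ccontr)
  assume less: "\<not> card A * (card A - 1) \<le> d"
  then have ne: "A \<noteq> {}" by auto
  let ?m = "card A - 1" and ?N = "d + card A - 1"
  let ?f = "stepanov_poly A ?N" and ?G = "\<Prod>b\<in>A. [:b, -1:] ^ ?m"
  have p': "prime (int p)" using p by simp
  have ndvd: "\<not> int p dvd x - y" if "x \<in> A" "y \<in> A" "x \<noteq> y" for x y
  proof
    assume "int p dvd x - y"
    then have "int p dvd (x - y) ^ d" using d by (meson dvd_power dvd_trans)
    then have "int p dvd 1" using diff[OF that] by (simp add: cong_dvd_iff)
    then show False using p' by (simp add: not_prime_unit)
  qed
  have "\<exists>q. [:int p:] dvd ?f - ?G * q"
  proof (rule dvd_mod_comaximal_prod[OF A])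
    show "comaximal_mod (int p) ([:x, -1:] ^ ?m) ([:y, -1:] ^ ?m)"
      if "x \<in> A" "y \<in> A" "x \<noteq> y" for x y
      using comaximal_mod_linear[OF p' ndvd[OF that]]
      by (meson comaximal_mod_commute comaximal_mod_power)
    show "\<exists>q. [:int p:] dvd ?f - [:b, -1:] ^ ?m * q" if "b \<in> A" for b
      by (rule stepanov_poly_vanishing[OF A that d diff])
  qed
  then obtain q where q: "[:int p:] dvd ?f - ?G * q" by blast
  have "degree ?G = card A * ?m"
    by (subst degree_prod_eq_sum_degree) (auto simp: degree_power_eq)
  moreover have "degree ?f \<le> d"
    using coeff_stepanov_poly[OF A ne d] by (intro degree_le) auto
  ultimately have "degree ?f < degree ?G" using less by simp
  moreover have "is_unit (lead_coeff ?G)"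
  proof -
    have "lead_coeff ?G = (\<Prod>b\<in>A. lead_coeff [:b, -1:] ^ ?m)"
      by (simp only: lead_coeff_prod lead_coeff_power)
    then show ?thesis by (simp add: power_abs)
  qed
  ultimately have "[:int p:] dvd ?f"
    using const_dvd_if_degree_less[OF _ q] p by (simp add: prime_gt_0_nat)
  then have "int p dvd coeff ?f d" by (simp add: const_poly_dvd_iff)
  then have "int p dvd of_nat (?N choose d) * node_product A"
    using coeff_stepanov_poly[OF A ne d order.refl]
    by (simp add: mult.assoc dvd_mult_unit_iff' is_unit_power_iff)
  then have "int p dvd int (?N choose d)"
    using not_dvd_node_product[OF p' A ndvd] p' by (simp add: prime_dvd_mult_iff)
  then have "p dvd (?N choose d)" by simp
  also have "(?N choose d) dvd fact ?N"
    using binomial_fact_lemma[of d ?N] ne A card_gt_0_iff[of A]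
    by (metis Nat.add_diff_assoc One_nat_def Suc_leI dvd_triv_right le_add1)
  finally show False
    using p card ne A card_gt_0_iff[of A] by (simp add: prime_dvd_fact_iff)
qed

text \<open>If \<open>card A \<le> d\<close>, then \<open>2 * d < p\<close> gives the size condition
  of the previous lemma. Otherwise a subset of \<open>d + 1\<close> elements meets that condition
  but violates the bound.\<close>

lemma difference_set_bound:
  fixes A :: "int set" and p d :: nat
  assumes p: "prime p" and A: "finite A" and d: "d > 0" "2 * d < p"
    and diff: "\<And>x y. x \<in> A \<Longrightarrow> y \<in> A \<Longrightarrow> x \<noteq> y \<Longrightarrow> [(x - y) ^ d = 1] (mod int p)"
  shows "card A * (card A - 1) \<le> d"
proof (cases "card A \<le> d")
  case True
  then show ?thesis using assms by (intro difference_set_bound_aux[of p]) auto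
next
  case False
  then obtain B where B: "B \<subseteq> A" "card B = d + 1"
    by (metis Suc_eq_plus1 not_less_eq_eq obtain_subset_with_card_n)
  have "card B * (card B - 1) \<le> d"
    using assms B finite_subset[of B A] by (intro difference_set_bound_aux[of p]) auto
  then show ?thesis using B d by simp
qed

section \<open>Difference sets equal to a group of roots of unity\<close>

context residues_prime
begin

lemma res_minus_eq: "a \<ominus> b = (a - b) mod int p"
  by (simp add: a_minus_def res_neg_eq res_add_eq mod_add_right_eq)

lemma unity_roots_eq: "unity_roots R d = {z \<in> {0..<int p}. [z ^ d = 1] (mod int p)}"
proof -
  have "z [^] d = \<one> \<longleftrightarrow> [z ^ d = 1] (mod int p)" if "z \<in> {0..<int p}" for z
    using pow_cong[of z d] that by (simp add: one_cong unique_euclidean_semiring_class.cong_def)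
  then show ?thesis by (auto simp: unity_roots_def res_carrier_eq)
qed

text \<open>With a primitive root \<open>g\<close> and \<open>p - 1 = k * d\<close>, the powers
  \<open>g ^ (k * i)\<close> for \<open>i < d\<close> are distinct \<open>d\<close>-th roots of
  unity.\<close>

lemma card_unity_roots_ge:
  assumes "d dvd p - 1"
  shows "d \<le> card (unity_roots R d)"
proof -
  have p1: "p > 1" using p_prime by (rule prime_gt_1_nat)
  obtain g where g: "residue_primroot p g"
    using Carmichael_eq_totient_imp_primroot[of p] p1 p_prime
    by (auto simp: Carmichael_prime totient_prime)
  obtain k where k: "p - 1 = k * d" using assms by (metis dvdE mult.commute)
  have inj: "inj_on (\<lambda>i. g ^ i mod p) {..<p - 1}"
    using residue_primroot_is_generator[OF p1 g] p_prime
    by (simp add: bij_betw_def totient_prime)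
  have kpos: "k > 0" "d > 0" using k p1 by (auto intro: gr0I)
  have "inj_on (\<lambda>i. int (g ^ (k * i) mod p)) {..<d}"
  proof (rule inj_onI)
    fix i j assume ij: "i \<in> {..<d}" "j \<in> {..<d}"
      "int (g ^ (k * i) mod p) = int (g ^ (k * j) mod p)"
    have "k * i \<in> {..<p - 1}" "k * j \<in> {..<p - 1}"
      unfolding k using ij(1,2) kpos by auto
    moreover have "g ^ (k * i) mod p = g ^ (k * j) mod p"
      using ij(3) by (rule of_nat_eq_iff[THEN iffD1])
    ultimately have "k * i = k * j"
      by (rule inj_onD[OF inj, rotated])
    then show "i = j" using kpos by simp
  qed
  moreover have "(\<lambda>i. int (g ^ (k * i) mod p)) ` {..<d} \<subseteq> unity_roots R d"
  proof safe
    fix i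
    have "coprime p g" using g by (auto simp: residue_primroot_def)
    then have "[g ^ (p - 1) = 1] (mod p)"
      using Residues.euler_theorem[of g p] p_prime by (simp add: totient_prime coprime_commute)
    then have "[(g ^ (p - 1)) ^ i = 1 ^ i] (mod p)" by (rule cong_pow)
    then have "[(g ^ (k * i)) ^ d = 1] (mod p)"
      unfolding k by (simp add: power_mult[symmetric] mult_ac)
    then have "[(g ^ (k * i) mod p) ^ d = 1] (mod p)"
      by (simp add: unique_euclidean_semiring_class.cong_def power_mod)
    then have "[int (g ^ (k * i) mod p) ^ d = 1] (mod int p)"
      by (metis cong_int_iff of_nat_1 of_nat_power)
    then show "int (g ^ (k * i) mod p) \<in> unity_roots R d"
      using p1 by (simp add: unity_roots_eq)
  qed
  moreover have "finite (unity_roots R d)"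
    by (rule finite_subset[of _ "{0..<int p}"]) (auto simp: unity_roots_eq)
  ultimately show ?thesis using card_inj_on_le by fastforce
qed

lemma differences_eq_unity_roots:
  assumes d: "d > 0" "d dvd p - 1" "d \<noteq> p - 1"
    and A: "A \<subseteq> carrier R"
    and eq: "distinct_differences R A = unity_roots R d"
  shows "card A * (card A - 1) = d"
    and "inj_on (\<lambda>(a, a'). a \<ominus> a') {(a, a') \<in> A \<times> A. a \<noteq> a'}"
proof -
  let ?P = "{(a, a') \<in> A \<times> A. a \<noteq> a'}" and ?f = "\<lambda>(a, a'). a \<ominus> a'"
  have p1: "p > 1" using p_prime by (rule prime_gt_1_nat)
  have fin: "finite A" using A finite finite_subset by blast
  then have finP: "finite ?P" by (rule_tac finite_subset[of _ "A \<times> A"]) auto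
  have img: "?f ` ?P = unity_roots R d"
    unfolding eq[symmetric] distinct_differences_def by auto
  have "?P = A \<times> A - (\<lambda>a. (a, a)) ` A" by auto
  then have "card ?P = card A * card A - card A"
    using fin by (simp add: card_Diff_subset image_subset_iff card_image inj_on_def card_cartesian_product)
  then have cardP: "card ?P = card A * (card A - 1)" by (simp add: diff_mult_distrib2)
  \<comment> \<open>As a proper divisor, \<open>d\<close> has a cofactor of at least 2, whence
    \<open>2 * d < p\<close>.\<close>
  obtain k where k: "p - 1 = d * k" using d by blast
  have "k \<noteq> 0" using k p1 by (cases k) auto
  moreover have "k \<noteq> 1" using k d(3) by auto
  ultimately have "d * 2 \<le> d * k" by (intro mult_le_mono2) linarith
  then have d2: "2 * d < p" using k p1 by linarith
  have "[(x - y) ^ d = 1] (mod int p)" if "x \<in> A" "y \<in> A" "x \<noteq> y" for x y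
  proof -
    have "x \<ominus> y \<in> unity_roots R d" using that img by force
    then show ?thesis by (simp add: unity_roots_eq res_minus_eq unique_euclidean_semiring_class.cong_def power_mod)
  qed
  then have le: "card A * (card A - 1) \<le> d"
    using difference_set_bound[OF p_prime fin d(1) d2] by blast
  \<comment> \<open>The chain from \<open>d\<close> through the cardinalities of the image and of
    \<open>?P\<close> back to \<open>d\<close> closes, so all its terms are equal.\<close>
  have "d \<le> card (?f ` ?P)" using card_unity_roots_ge[OF d(2)] img by simp
  moreover have "card (?f ` ?P) \<le> card ?P" by (rule card_image_le[OF finP])
  ultimately have eqs: "card (?f ` ?P) = card ?P" "card ?P = d" using le cardP by linarith+
  show "card A * (card A - 1) = d" using eqs cardP by simp
  show "inj_on ?f ?P" by (rule eq_card_imp_inj_on[OF finP eqs(1)])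
qed

end

section \<open>The case of index two: shape and number of the exceptional primes\<close>

lemma eq_half_square_plus_1:
  fixes m :: nat
  assumes "real p = 2 * real (m * (m - 1)) + 1"
  shows "real p = (real_of_int (2 * int m - 1) ^ 2 + 1) / 2"
  \<comment> \<open>Completing the square: \<open>(2 * m - 1) ^ 2 = 4 * m * (m - 1) + 1\<close>. The
    case split handles truncated subtraction at \<open>m = 0\<close>.\<close>
  using assms by (cases m) (auto simp: power2_eq_square field_simps)

lemma half_group_order:
  assumes "prime p" "odd p" "A \<subseteq> carrier (prime_field p)"
    and "distinct_differences (prime_field p) A = unity_roots (prime_field p) ((p - 1) div 2)"
  shows "p = 2 * (card A * (card A - 1)) + 1"
proof -
  have "p > 2" using assms(1,2) by (metis prime_gt_1_nat Suc_1 Suc_lessI even_numeral One_nat_def)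
  interpret residues_prime p "prime_field p" by unfold_locales (use assms in auto)
  have "2 * ((p - 1) div 2) = p - 1" using assms(2) by simp
  moreover from this have "card A * (card A - 1) = (p - 1) div 2"
    using \<open>p > 2\<close> assms by (intro differences_eq_unity_roots) (auto intro: dvdI[of _ _ 2])
  ultimately show ?thesis using \<open>p > 2\<close> by simp
qed

text \<open>An exceptional prime is determined by \<open>card A\<close>, and
  \<open>(card A - 1) ^ 2 \<le> p \<le> x\<close> leaves at most \<open>sqrt x + 2\<close> values of
  \<open>card A\<close>, counting 0.\<close>

lemma card_exceptional_le:
  assumes "x \<ge> 0"
  shows "real (card {p :: nat. prime p \<and> odd p \<and> real p \<le> x \<and>
         (\<exists>A \<subseteq> carrier (prime_field p).
            distinct_differences (prime_field p) A =
            unity_roots (prime_field p) ((p - 1) div 2))}) \<le> sqrt x + 2"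
    (is "real (card ?S) \<le> _")
proof -
  define M where "M = nat \<lfloor>sqrt x + 1\<rfloor>"
  have "?S \<subseteq> (\<lambda>m. 2 * (m * (m - 1)) + 1) ` {..M}"
  proof
    fix p assume p: "p \<in> ?S"
    then obtain A where "A \<subseteq> carrier (prime_field p)"
      "distinct_differences (prime_field p) A = unity_roots (prime_field p) ((p - 1) div 2)"
      by blast
    then have eq: "p = 2 * (card A * (card A - 1)) + 1"
      using p half_group_order by blast
    have "(card A - 1) ^ 2 \<le> p"
    proof -
      have "(card A - 1) ^ 2 \<le> card A * (card A - 1)"
        unfolding power2_eq_square by (intro mult_le_mono1) simp
      then show ?thesis using eq by linarith
    qed
    then have "real ((card A - 1) ^ 2) \<le> x" using p of_nat_mono[of "(card A - 1) ^ 2" p, where 'a = real] by (auto simp del: of_nat_power)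
    then have "real (card A - 1) \<le> sqrt x" by (intro real_le_rsqrt) simp
    then have "real (card A) \<le> sqrt x + 1" by linarith
    then have "card A \<le> M" unfolding M_def by (rule le_nat_floor)
    then show "p \<in> (\<lambda>m. 2 * (m * (m - 1)) + 1) ` {..M}" using eq by blast
  qed
  then have "card ?S \<le> card {..M}" by (rule surj_card_le[rotated]) simp
  then have "real (card ?S) \<le> real M + 1" by simp
  also have "real M \<le> sqrt x + 1" using assms by (simp add: M_def)
  finally show ?thesis by simp
qed

section \<open>A lower bound for the number of primes\<close>

text \<open>The numbers \<open>1 / ((n + 1) * (n choose k))\<close> form the Leibniz harmonic triangle.\<close>

lemma Lcm_div_binomial:
  assumes "k \<le> n" "n < N"
  shows "real (Lcm {1..N}) / (real (n + 1) * real (n choose k)) \<in> \<int>"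
  using assms
proof (induction k arbitrary: n)
  case 0
  have "n + 1 dvd Lcm {1..N}" using 0 by (intro dvd_Lcm) auto
  then obtain t where "Lcm {1..N} = (n + 1) * t" by (elim dvdE)
  then have "real (Lcm {1..N}) = real (n + 1) * real t" by (metis of_nat_mult)
  then show ?case by simp
next
  case (Suc k)
  then obtain m where n: "n = Suc m" and km: "k \<le> m" by (cases n) auto
  have 1: "real (k + 1) * real (n choose (k + 1)) = real n * real (m choose k)"
    using Suc_times_binomial[of k m] n by (metis Suc_eq_plus1 of_nat_mult)
  have 2: "(real n - real k) * real (n choose k) = real n * real (m choose k)"
    using binomial_absorb_comp[of n k] n km
    by (metis Suc.prems(1) Suc_leD diff_Suc_1 of_nat_diff of_nat_mult)
  have pos: "real (m choose k) > 0" "real (n choose k) > 0" "real (n choose (k+1)) > 0"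
    using km Suc.prems(1) by simp_all
  have kn: "real n - real k > 0" "real n > 0" using km n by simp_all
  have e1: "real (n choose (k+1)) = real n * real (m choose k) / real (k + 1)"
    using 1 by (simp add: field_simps)
  have e2: "real (n choose k) = real n * real (m choose k) / (real n - real k)"
    using 2 kn by (simp add: field_simps)
  \<comment> \<open>The recurrence of the triangle: an entry is the one in the previous row minus
    its left neighbour. Integrality thus spreads from the column \<open>k = 0\<close>.\<close>
  have "1 / (real (n + 1) * real (n choose (k + 1)))
      = 1 / (real (m + 1) * real (m choose k)) - 1 / (real (n + 1) * real (n choose k))"
    unfolding e1 e2 using pos kn n by (simp add: divide_simps)
  then have "real (Lcm {1..N}) / (real (n + 1) * real (n choose Suc k))
      = real (Lcm {1..N}) / (real (m + 1) * real (m choose k))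
        - real (Lcm {1..N}) / (real (n + 1) * real (n choose k))"
    by (metis Suc_eq_plus1 mult.right_neutral right_diff_distrib times_divide_eq_right)
  then show ?case
    using Suc.IH[of m] Suc.IH[of n] Suc.prems km n by simp
qed

text \<open>By the previous lemma each \<open>(n + 1) * (n choose k)\<close> divides the least
  common multiple; sum the resulting inequalities over the row.\<close>

lemma power_2_le_Lcm: "2 ^ n \<le> Lcm {1..n + 1}"
proof -
  have Lpos: "Lcm {1..n + 1} > 0" by (simp add: Lcm_0_iff_nat neq0_conv[symmetric] del: neq0_conv)
  have "(n + 1) * (n choose k) \<le> Lcm {1..n + 1}" if k: "k \<le> n" for k
  proof -
    let ?b = "real (n + 1) * real (n choose k)"
    have b: "?b > 0" using k by (simp add: add_pos_nonneg)
    then have "real (Lcm {1..n + 1}) / ?b > 0" using Lpos by simp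
    then have "real (Lcm {1..n + 1}) / ?b \<ge> 1"
      using Lcm_div_binomial[OF k, of "n + 1"] by (auto elim!: Ints_cases)
    then have "?b \<le> real (Lcm {1..n + 1})" using b by (simp add: le_divide_eq)
    then show ?thesis by (metis of_nat_le_iff of_nat_mult)
  qed
  then have "(\<Sum>k\<le>n. (n + 1) * (n choose k)) \<le> (\<Sum>k\<le>n. Lcm {1..n + 1})"
    by (intro sum_mono) auto
  then have "(n + 1) * 2 ^ n \<le> (n + 1) * Lcm {1..n + 1}"
    unfolding sum_distrib_left[symmetric] choose_row_sum by simp
  then show ?thesis unfolding mult_le_cancel1 by simp
qed

text \<open>The least common multiple divides the product, over primes \<open>q \<le> N\<close>, of
  the largest power of \<open>q\<close> not above \<open>N\<close>; each factor is at most
  \<open>N\<close>.\<close>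

lemma Lcm_le_power_prime_count:
  fixes N :: nat
  shows "Lcm {1..N} \<le> N ^ card {q. prime q \<and> q \<le> N}"
proof -
  define e where "e q = Max {i. q ^ i \<le> N}" for q
  let ?Q = "{q. prime q \<and> q \<le> N}"
  have finQ: "finite ?Q" by (rule finite_subset[of _ "{..N}"]) auto
  have fin: "finite {i. q ^ i \<le> N}" if "prime q" for q
  proof (rule finite_subset)
    have "i < q ^ i" for i using prime_gt_1_nat[OF that] by (simp add: power_gt_expt)
    then show "{i. q ^ i \<le> N} \<subseteq> {..N}" by (auto intro: order.strict_implies_order order.strict_trans2)
  qed simp
  have "k dvd (\<Prod>q\<in>?Q. q ^ e q)" if k: "k \<in> {1..N}" for k
  proof -
    have "k = (\<Prod>q\<in>prime_factors k. q ^ multiplicity q k)"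
      using k by (simp add: prime_factorization_nat)
    also have "\<dots> dvd (\<Prod>q\<in>?Q. q ^ e q)"
    proof (rule prod_dvd_prod_subset2)
      show "prime_factors k \<subseteq> ?Q"
        using k by (auto simp: prime_factors_dvd dest!: dvd_imp_le)
      fix q assume q: "q \<in> prime_factors k"
      have "q ^ multiplicity q k \<le> k"
        using k by (intro dvd_imp_le multiplicity_dvd) auto
      then have "multiplicity q k \<le> e q"
        unfolding e_def using q k fin[of q] by (intro Max_ge) auto
      then show "q ^ multiplicity q k dvd q ^ e q" by (rule le_imp_power_dvd)
    qed (rule finQ)
    finally show ?thesis .
  qed
  then have "Lcm {1..N} dvd (\<Prod>q\<in>?Q. q ^ e q)" by (rule Lcm_least)
  moreover have "(\<Prod>q\<in>?Q. q ^ e q) > 0" by (intro prod_pos) (auto simp: prime_gt_0_nat)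
  ultimately have "Lcm {1..N} \<le> (\<Prod>q\<in>?Q. q ^ e q)" by (rule dvd_imp_le)
  also have "\<dots> \<le> (\<Prod>q\<in>?Q. N)"
  proof (intro prod_mono conjI)
    fix q assume q: "q \<in> ?Q"
    then have "q ^ 1 \<le> N" by simp
    then have "e q \<in> {i. q ^ i \<le> N}"
      unfolding e_def using q fin by (intro Max_in) blast+
    then show "q ^ e q \<le> N" by simp
  qed simp
  finally show ?thesis by simp
qed

lemma prime_pi_lower_bound:
  assumes "x \<ge> 2"
  shows "(x - 2) * ln 2 / ln x \<le> real (prime_pi x)"
proof -
  define N where "N = nat \<lfloor>x\<rfloor>"
  have N: "N \<ge> 2" "real N \<le> x" "x < real N + 1"
    using assms by (auto simp: N_def le_nat_floor)
  have iff: "real q \<le> x \<longleftrightarrow> q \<le> N" for q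
    using assms by (simp add: N_def le_nat_floor le_nat_iff le_floor_iff)
  have "2 ^ (N - 1) \<le> Lcm {1..N}" using power_2_le_Lcm[of "N - 1"] N by simp
  also have "\<dots> \<le> N ^ prime_pi x"
    using Lcm_le_power_prime_count[of N] by (simp add: prime_pi_def iff)
  finally have "(2::real) ^ (N - 1) \<le> real N ^ prime_pi x"
    by (metis of_nat_le_iff of_nat_numeral of_nat_power)
  then have "ln ((2::real) ^ (N - 1)) \<le> ln (real N ^ prime_pi x)"
    using N by (subst ln_le_cancel_iff) auto
  then have "real (N - 1) * ln 2 \<le> real (prime_pi x) * ln N"
    using N by (simp add: ln_realpow)
  also have "\<dots> \<le> real (prime_pi x) * ln x"
    using N by (intro mult_left_mono) auto
  finally have "real (N - 1) * ln 2 \<le> real (prime_pi x) * ln x" .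
  \<comment> \<open>The loss of 2 combines rounding \<open>x\<close> down to \<open>N\<close> and
    the exponent \<open>N - 1\<close>.\<close>
  moreover have "(x - 2) * ln 2 \<le> real (N - 1) * ln 2"
    using N by (intro mult_right_mono) auto
  ultimately have "(x - 2) * ln 2 \<le> real (prime_pi x) * ln x" by linarith
  moreover have "ln x > 0" using assms by simp
  ultimately show ?thesis by (simp add: divide_le_eq)
qed

text \<open>The order \<open>x / ln x\<close> of the lower bound already dominates
  \<open>sqrt x\<close>.\<close>

lemma sqrt_smallo_prime_pi: "(\<lambda>x. sqrt x + 2) \<in> o(\<lambda>x. real (prime_pi x))"
proof -
  have "(\<lambda>x::real. sqrt x + 2) \<in> o(\<lambda>x. (x - 2) * ln 2 / ln x)" by real_asymp
  also have "(\<lambda>x. (x - 2) * ln 2 / ln x) \<in> O(\<lambda>x. real (prime_pi x))"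
    using prime_pi_lower_bound
    by (intro bigoI[of _ 1] eventually_mono[OF eventually_ge_at_top[of 2]]) auto
  finally show ?thesis .
qed

theorem corollary1p6:
  shows
    "(\<forall>(p :: nat) (d :: nat) (A :: int set).
       prime p \<and> even d \<and> d > 0 \<and> d dvd p - 1 \<and> d \<noteq> p - 1
       \<and> A \<subseteq> carrier (prime_field p)
       \<and> distinct_differences (prime_field p) A = unity_roots (prime_field p) d
       \<longrightarrow>
       (\<forall>a1\<in>A. \<forall>a1'\<in>A. \<forall>a2\<in>A. \<forall>a2'\<in>A.
          a1 \<noteq> a1' \<and> a2 \<noteq> a2'
          \<and> a1 \<ominus>\<^bsub>prime_field p\<^esub> a1' = a2 \<ominus>\<^bsub>prime_field p\<^esub> a2'
          \<longrightarrow> (a1, a1') = (a2, a2'))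
       \<and> (real d = (real p - 1) / 2 \<longrightarrow>
            (\<exists>n :: int. odd n \<and> real p = (real_of_int n ^ 2 + 1) / 2)))
     \<and>
     (\<lambda>x :: real. real (card {p :: nat. prime p \<and> odd p \<and> real p \<le> x \<and>
         (\<exists>A \<subseteq> carrier (prime_field p).
            distinct_differences (prime_field p) A =
            unity_roots (prime_field p) ((p - 1) div 2))}))
       \<in> o[at_top](\<lambda>x. real (prime_pi x))"
proof (intro conjI allI impI)
  fix p d :: nat and A :: "int set"
  assume h: "prime p \<and> even d \<and> d > 0 \<and> d dvd p - 1 \<and> d \<noteq> p - 1
       \<and> A \<subseteq> carrier (prime_field p)
       \<and> distinct_differences (prime_field p) A = unity_roots (prime_field p) d"
  then interpret residues_prime p "prime_field p" by unfold_locales auto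
  note eq = differences_eq_unity_roots[of d A]
  show "\<forall>a1\<in>A. \<forall>a1'\<in>A. \<forall>a2\<in>A. \<forall>a2'\<in>A.
          a1 \<noteq> a1' \<and> a2 \<noteq> a2'
          \<and> a1 \<ominus>\<^bsub>prime_field p\<^esub> a1' = a2 \<ominus>\<^bsub>prime_field p\<^esub> a2'
          \<longrightarrow> (a1, a1') = (a2, a2')"
  proof (intro ballI impI)
    fix a1 a1' a2 a2'
    assume "a1 \<in> A" "a1' \<in> A" "a2 \<in> A" "a2' \<in> A" "a1 \<noteq> a1' \<and> a2 \<noteq> a2'
      \<and> a1 \<ominus>\<^bsub>prime_field p\<^esub> a1' = a2 \<ominus>\<^bsub>prime_field p\<^esub> a2'"
    then show "(a1, a1') = (a2, a2')"
      using h by (intro inj_onD[OF eq(2)]) simp_all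
  qed
  assume "real d = (real p - 1) / 2"
  then have "real p = 2 * real (card A * (card A - 1)) + 1"
    using eq(1) h by simp
  then have "real p = (real_of_int (2 * int (card A) - 1) ^ 2 + 1) / 2"
    by (rule eq_half_square_plus_1)
  then show "\<exists>n :: int. odd n \<and> real p = (real_of_int n ^ 2 + 1) / 2"
    by (intro exI[of _ "2 * int (card A) - 1"]) simp
next
  let ?S = "\<lambda>x. {p :: nat. prime p \<and> odd p \<and> real p \<le> x \<and>
         (\<exists>A \<subseteq> carrier (prime_field p).
            distinct_differences (prime_field p) A =
            unity_roots (prime_field p) ((p - 1) div 2))}"
  have "(\<lambda>x. real (card (?S x))) \<in> O(\<lambda>x. sqrt x + 2)"
    using card_exceptional_le
    by (intro bigoI[of _ 1] eventually_mono[OF eventually_ge_at_top[of 0]]) auto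
  then show "(\<lambda>x. real (card (?S x))) \<in> o(\<lambda>x. real (prime_pi x))"
    using sqrt_smallo_prime_pi by (rule landau_o.big_small_trans)
qed

end
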